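(* Let $R\subset\mathbb{R}$ be a subring with $1\in R$, let $I$ be an interval with $\inf I=0$, and let $\mathscr{M}$ be an $R$-weighted mean on $I$ which is continuous in its weights. Then the mapping $\mathscr{H}_{\mathscr{M}}\colon W^0(R)\to[-\infty,+\infty]$, $\lambda\mapsto\mathscr{H}_{\mathscr{M}}(\lambda)$, is lower semicontinuous in the pointwise topology on $W^0(R)$.
   Context: $\mathbb{N}$ denotes the positive integers. Let $R\subset\mathbb{R}$ be a ring with $1\in R$, and $W_n(R):=\{(\lambda_1,\dots,\lambda_n)\in R^n : \lambda_i\ge 0,\ \lambda_1+\dots+\lambda_n>0\}$. An $R$-weighted mean on an interval $I$ is a function $\mathscr{M}\colon\bigcup_{n=1}^\infty I^n\times W_n(R)\to I$ such that: (i) $\mathscr{M}(x,\lambda)=\mathscr{M}(x,t\lambda)$ for all $(x,\lambda)\in I^n\times W_n(R)$ and $t\in R$, $t>0$ (nullhomogeneity in the weights); (ii) $\mathscr{M}(x,\lambda+\mu)=\mathscr{M}(x\odot x,\lambda\odot\mu)$ for all $x\in I^n$, $\lambda,\mu\in W_n(R)$, where $(p_1,\dots,p_n)\odot(q_1,\dots,q_n):=(p_1,q_1,\dots,p_n,q_n)$ (reduction principle); (iii) $\min_i x_i\le\mathscr{M}(x,\lambda)\le\max_i x_i$ (mean value property); (iv) entries with zero weight can be omitted, i.e. deleting $x_j$ and $\lambda_j$ when $\lambda_j=0$ does not change the value (elimination principle). $\mathscr{M}$ is continuous in its weights if for all $n$ and $x\in I^n$ the map $W_n(R)\ni\lambda\mapsto\mathscr{M}(x,\lambda)$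 is continuous. $W^0(R)$ is the set of infinite sequences with all terms in $R\cap(0,+\infty)$. For $I$ with $\inf I=0$ and $\lambda\in W^0(R)$, the $\lambda$-weighted Hardy constant $\mathscr{H}_{\mathscr{M}}(\lambda)$ is the smallest extended real number $C$ such that $\sum_{n=1}^\infty\lambda_n\,\mathscr{M}\big((x_1,\dots,x_n),(\lambda_1,\dots,\lambda_n)\big)\le C\sum_{n=1}^\infty\lambda_nx_n$ for all sequences $(x_n)_{n=1}^\infty$ in $I$ (equivalently, for all those with $\sum_n\lambda_n x_n<\infty$). Convergence $\psi^{(k)}\to\lambda$ in the pointwise topology means $\lim_{k\to\infty}\psi^{(k)}_n=\lambda_n$ for every $n\in\mathbb{N}$. Lower semicontinuity means: whenever $\psi^{(k)},\lambda\in W^0(R)$ and $\psi^{(k)}\to\lambda$ in the pointwise topology, $\liminf_{k\to\infty}\mathscr{H}_{\mathscr{M}}(\psi^{(k)})\ge\mathscr{H}_{\mathscr{M}}(\lambda)$. *)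

theory Defs
  imports "HOL-Analysis.Analysis"
begin

(* An n-tuple is a list of length n.  Infinite sequences are functions on nat,
   so the term with (1-based) number n is the value at n - 1. *)

definition unital_subring :: "real set \<Rightarrow> bool" where
  "unital_subring R \<longleftrightarrow> 0 \<in> R \<and> 1 \<in> R \<and>
     (\<forall>a\<in>R. \<forall>b\<in>R. a + b \<in> R) \<and> (\<forall>a\<in>R. - a \<in> R) \<and> (\<forall>a\<in>R. \<forall>b\<in>R. a * b \<in> R)"

definition tuples :: "nat \<Rightarrow> 'a set \<Rightarrow> 'a list set" where
  "tuples n A = {xs. length xs = n \<and> set xs \<subseteq> A}"

(* weights 0 R is empty, so the restriction n > 0 is implied by membership. *)
definition weights :: "nat \<Rightarrow> real set \<Rightarrow> real list set" where
  "weights n R = {l \<in> tuples n R. (\<forall>a\<in>set l. 0 \<le> a) \<and> 0 < sum_list l}"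

definition delete_nth :: "nat \<Rightarrow> 'a list \<Rightarrow> 'a list" where
  "delete_nth j xs = take j xs @ drop (Suc j) xs"

(* A mean is a total function on pairs of lists, of which only the values M xs l
   with xs in tuples n I and l in weights n R matter.  The library function
   splice is the shuffle (p1, q1, ..., pn, qn) of two lists of equal length. *)
definition weighted_mean :: "real set \<Rightarrow> real set \<Rightarrow> (real list \<Rightarrow> real list \<Rightarrow> real) \<Rightarrow> bool" where
  "weighted_mean R I M \<longleftrightarrow>
     (\<forall>n. \<forall>xs\<in>tuples n I. \<forall>l\<in>weights n R. M xs l \<in> I) \<and>
     (\<forall>n. \<forall>xs\<in>tuples n I. \<forall>l\<in>weights n R. \<forall>t\<in>R. 0 < t \<longrightarrow> M xs l = M xs (map ((*) t) l)) \<and>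
     (\<forall>n. \<forall>xs\<in>tuples n I. \<forall>l\<in>weights n R. \<forall>m\<in>weights n R.
        M xs (map2 (+) l m) = M (splice xs xs) (splice l m)) \<and>
     (\<forall>n. \<forall>xs\<in>tuples n I. \<forall>l\<in>weights n R. Min (set xs) \<le> M xs l \<and> M xs l \<le> Max (set xs)) \<and>
     (\<forall>n. \<forall>xs\<in>tuples n I. \<forall>l\<in>weights n R. \<forall>j<n.
        l ! j = 0 \<longrightarrow> M (delete_nth j xs) (delete_nth j l) = M xs l)"

(* The product topology of the n-th power of the reals, carried over to lists of length n. *)
definition tuple_topology :: "nat \<Rightarrow> real list topology" where
  "tuple_topology n =
     pullback_topology (tuples n UNIV) (\<lambda>l. \<lambda>i\<in>{..<n}. l ! i)
       (product_topology (\<lambda>_. euclideanreal) {..<n})"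

definition continuous_in_weights ::
    "real set \<Rightarrow> real set \<Rightarrow> (real list \<Rightarrow> real list \<Rightarrow> real) \<Rightarrow> bool" where
  "continuous_in_weights R I M \<longleftrightarrow>
     (\<forall>n. \<forall>xs\<in>tuples n I.
        continuous_map (subtopology (tuple_topology n) (weights n R)) euclideanreal (M xs))"

definition W0 :: "real set \<Rightarrow> (nat \<Rightarrow> real) set" where
  "W0 R = {w. \<forall>n. w n \<in> R \<and> 0 < w n}"

(* All terms of both series are nonnegative in the intended use.  In ereal,
   0 * \<infinity> = 0 and 0 * (-\<infinity>) = 0.  The infimum is attained:
   see weighted_Hardy_constant_is_least below. *)
definition weighted_Hardy_inequality ::
    "real set \<Rightarrow> (real list \<Rightarrow> real list \<Rightarrow> real) \<Rightarrow> (nat \<Rightarrow> real) \<Rightarrow> ereal \<Rightarrow> bool" where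
  "weighted_Hardy_inequality I M w C \<longleftrightarrow>
     (\<forall>x. range x \<subseteq> I \<longrightarrow>
        (\<Sum>n. ereal (w n * M (map x [0..<Suc n]) (map w [0..<Suc n])))
          \<le> C * (\<Sum>n. ereal (w n * x n)))"

definition weighted_Hardy_constant ::
    "real set \<Rightarrow> (real list \<Rightarrow> real list \<Rightarrow> real) \<Rightarrow> (nat \<Rightarrow> real) \<Rightarrow> ereal" where
  "weighted_Hardy_constant I M w = Inf {C. weighted_Hardy_inequality I M w C}"

definition pointwise_lower_semicontinuous_on ::
    "(nat \<Rightarrow> real) set \<Rightarrow> ((nat \<Rightarrow> real) \<Rightarrow> ereal) \<Rightarrow> bool" where
  "pointwise_lower_semicontinuous_on S F \<longleftrightarrow>
     (\<forall>\<psi> w. (\<forall>k. \<psi> k \<in> S) \<longrightarrow> w \<in> S \<longrightarrow> (\<forall>n. (\<lambda>k. \<psi> k n) \<longlonglongrightarrow> w n) \<longrightarrow>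
        liminf (\<lambda>k. F (\<psi> k)) \<ge> F w)"

lemma weighted_Hardy_constant_is_least:
  assumes I: "(INF x\<in>I. ereal x) = 0" and M: "weighted_mean R I M" and w: "w \<in> W0 R"
  shows "weighted_Hardy_inequality I M w (weighted_Hardy_constant I M w)"
    and "weighted_Hardy_inequality I M w C \<Longrightarrow> weighted_Hardy_constant I M w \<le> C"
proof -
  let ?H = "weighted_Hardy_constant I M w"
  let ?L = "\<lambda>x. \<Sum>n. ereal (w n * M (map x [0..<Suc n]) (map w [0..<Suc n]))"
  let ?S = "\<lambda>x. \<Sum>n. ereal (w n * x n)"
  have wpos: "0 < w n" for n using w by (simp add: W0_def)
  have Inn: "0 \<le> v" if "v \<in> I" for v
    using INF_lower[OF that, of ereal] I by simp
  have small: "\<exists>v\<in>I. v < e" if "0 < e" for e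
  proof -
    have "(INF x\<in>I. ereal x) < ereal e" using I that by simp
    then show ?thesis by (auto simp: INF_less_iff)
  qed
  have wt: "map w [0..<Suc n] \<in> weights (Suc n) R" for n
    using w wpos unfolding weights_def tuples_def W0_def
    by (auto simp: less_imp_le interv_sum_list_conv_sum_set_nat
             intro!: add_nonneg_pos sum_nonneg)
  have tp: "map x [0..<Suc n] \<in> tuples (Suc n) I" if "range x \<subseteq> I" for x :: "nat \<Rightarrow> real" and n
    using that by (auto simp: tuples_def)
  note mean_defn = M[unfolded weighted_mean_def]
  note mean =
    mean_defn[THEN conjunct1]
    mean_defn[THEN conjunct2, THEN conjunct2, THEN conjunct2, THEN conjunct1]
  have MI: "M (map x [0..<Suc n]) (map w [0..<Suc n]) \<in> I" if "range x \<subseteq> I" for x n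
    using mean(1)[rule_format, OF tp[OF that] wt] .
  have Mge: "Min (set (map x [0..<Suc n])) \<le> M (map x [0..<Suc n]) (map w [0..<Suc n])"
    and Mle: "M (map x [0..<Suc n]) (map w [0..<Suc n]) \<le> Max (set (map x [0..<Suc n]))"
    if "range x \<subseteq> I" for x n
    using mean(2)[rule_format, OF tp[OF that] wt] by blast+
  have Lt: "0 \<le> ereal (w n * M (map x [0..<Suc n]) (map w [0..<Suc n]))" if "range x \<subseteq> I" for x n
    using Inn[OF MI[OF that, of n]] wpos[of n] by simp
  have St: "0 \<le> ereal (w n * x n)" if "range x \<subseteq> I" for x n
    using Inn[OF range_subsetD[OF that]] wpos by (simp add: less_imp_le)
  have first: "u 0 \<le> (\<Sum>n. u n)" if "\<And>n. 0 \<le> u n" for u :: "nat \<Rightarrow> ereal"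
    using suminf_upper[of u "Suc 0"] that by simp
  have L0: "ereal (w 0 * x 0) \<le> ?L x" if "range x \<subseteq> I" for x
  proof -
    have "x 0 \<le> M (map x [0..<Suc 0]) (map w [0..<Suc 0])"
      using Mge[OF that, of 0] by simp
    then have "ereal (w 0 * x 0) \<le> ereal (w 0 * M (map x [0..<Suc 0]) (map w [0..<Suc 0]))"
      using wpos[of 0] by simp
    also have "\<dots> \<le> ?L x"
      by (rule first) (rule Lt[OF that])
    finally show ?thesis .
  qed
  have dv: "a / s \<le> b \<longleftrightarrow> a \<le> b * s" if "0 < s" "s < \<infinity>" for a b s :: ereal
    using that by (cases s) (auto simp: ereal_divide_le_pos mult.commute)
  show "weighted_Hardy_inequality I M w ?H"
    unfolding weighted_Hardy_inequality_def
  proof (intro allI impI)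
    fix x :: "nat \<Rightarrow> real" assume x: "range x \<subseteq> I"
    have Snn: "0 \<le> ?S x" by (intro suminf_0_le St x)
    consider "?S x = 0" | "0 < ?S x" "?S x < \<infinity>" | "?S x = \<infinity>"
      using Snn by force
    then show "?L x \<le> ?H * ?S x"
    proof cases
      case 1
      have "x n = 0" for n
      proof -
        have "ereal (w n * x n) = 0"
          using 1 suminf_ereal_eq_0[of "\<lambda>n. ereal (w n * x n)", OF St[OF x]] by simp
        then show ?thesis using wpos[of n] by simp
      qed
      then have x0: "x = (\<lambda>_. 0)" by auto
      have "M (map x [0..<Suc n]) (map w [0..<Suc n]) = 0" for n
      proof -
        have "set (map x [0..<Suc n]) = {0}" using x0 by auto
        from Mle[OF x, of n, unfolded this] Mge[OF x, of n, unfolded this]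
        show ?thesis by (simp only: Max_singleton Min_singleton)
      qed
      then show ?thesis using 1 by (simp flip: zero_ereal_def)
    next
      case 2
      have "?L x / ?S x \<le> ?H"
        unfolding weighted_Hardy_constant_def
        using 2 x by (intro Inf_greatest)
          (auto simp: weighted_Hardy_inequality_def dv)
      then show ?thesis using 2 by (simp add: dv)
    next
      case 3
      obtain m where m: "0 < x m"
      proof -
        have "\<exists>m. x m \<noteq> 0" using 3 by (rule contrapos_pp) (simp flip: zero_ereal_def)
        then show ?thesis using that Inn x by (metis less_eq_real_def range_subsetD)
      qed
      have "\<exists>v\<in>I. v < (1/2)^n / w n" for n using small wpos[of n] by simp
      then obtain z where zI: "\<And>n. z n \<in> I" and z: "\<And>n. z n < (1/2)^n / w n" by metis
      define y where "y = z(0 := x m)"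
      have y: "range y \<subseteq> I" using zI x by (auto simp: y_def)
      have "?S y \<le> (\<Sum>n. ereal ((1/2)^n + (if n = 0 then w 0 * x m else 0)))"
      proof (rule suminf_le_pos)
        show "0 \<le> ereal (w n * y n)" for n by (rule St[OF y])
        show "ereal (w n * y n) \<le> ereal ((1/2)^n + (if n = 0 then w 0 * x m else 0))" for n
          using z[of n] wpos[of n] by (auto simp: y_def field_simps)
      qed
      also have "\<dots> < \<infinity>"
      proof -
        have "summable (\<lambda>n. (1/2)^n + (if n = 0 then w 0 * x m else 0) :: real)"
          by (intro summable_add summable_geometric summable_single) simp
        then show ?thesis by (simp add: suminf_ereal')
      qed
      finally have Sy: "?S y < \<infinity>" .
      have Ly: "0 < ereal (w 0 * x m)" using m wpos[of 0] by simp
      have Cy: "ereal (w 0 * x m) \<le> ?L y" using L0[OF y] by (simp add: y_def)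
      have "ereal (w 0 * x m) = ereal (w 0 * y 0)" by (simp add: y_def)
      also have "\<dots> \<le> ?S y"
        by (rule first) (rule St[OF y])
      finally have Sy0: "0 < ?S y" using Ly by (rule less_le_trans[rotated])
      have "ereal (w 0 * x m) / ?S y \<le> ?H"
        unfolding weighted_Hardy_constant_def
      proof (rule Inf_greatest)
        fix C assume "C \<in> {C. weighted_Hardy_inequality I M w C}"
        then have "?L y \<le> C * ?S y" using y by (simp add: weighted_Hardy_inequality_def)
        then show "ereal (w 0 * x m) / ?S y \<le> C"
          using Cy by (simp add: dv[OF Sy0 Sy])
      qed
      moreover have "0 < ereal (w 0 * x m) / ?S y"
        using Ly Sy Sy0 by (cases "?S y") auto
      ultimately have "0 < ?H" by simp
      then have "?H * ?S x = \<infinity>" using 3 by (simp add: ereal_mult_eq_PInfty)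
      then show ?thesis by (simp only: ereal_less_eq)
    qed
  qed
  show "weighted_Hardy_inequality I M w C \<Longrightarrow> ?H \<le> C"
    unfolding weighted_Hardy_constant_def by (rule Inf_lower) simp
qed

end

theory Submission
  imports Defs
begin

text \<open>
  The Hardy constant is lower semicontinuous because violating the Hardy inequality is an open
  condition on the weights. For a weight sequence \<open>w\<close>, a constant \<open>c\<close> lies strictly below the
  Hardy constant exactly if some sequence \<open>x\<close> violates the inequality with constant \<open>c\<close>. It
  therefore suffices to turn such an \<open>x\<close> into a violating sequence for every \<open>\<psi> k\<close> with \<open>k\<close> large.

  If \<open>c < 0\<close>, then \<open>x\<close> is not identically zero, and this alone makes it violate the inequality for
  every weight sequence, since the right-hand side is negative.

  If \<open>c \<ge> 0\<close>, finitely many terms already witness the violation: for some \<open>N\<close>, the sum of the first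
  \<open>N\<close> terms on the left exceeds \<open>c\<close> times the corresponding partial sum on the right. These two
  partial sums involve only finitely many weights, and they depend continuously on them
  (\<open>prefix_mean_tendsto\<close>), so the strict inequality, with a little room \<open>e\<close> to spare, persists for
  \<open>\<psi> k\<close>. Beyond \<open>N\<close> the terms of \<open>x\<close> can make the right-hand side for
  \<open>\<psi> k\<close> large, even infinite, as pointwise convergence does not control the tail of the
  weights. But the tail of \<open>x\<close> may be replaced, separately for each
  \<open>k\<close>, by elements of the interval so small that they contribute at most \<open>e\<close> to the
  series on the right (\<open>extension_with_small_tail\<close>); on the left, the new terms are nonnegative.
\<close>

lemma prefix_in_tuples: "range x \<subseteq> A \<Longrightarrow> map x [0..<n] \<in> tuples n A"
  by (auto simp: tuples_def)

lemma prefix_in_weights: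
  assumes "w \<in> W0 R"
  shows "map w [0..<Suc n] \<in> weights (Suc n) R"
  using assms unfolding weights_def tuples_def W0_def
  by (auto simp: less_imp_le interv_sum_list_conv_sum_set_nat intro!: add_nonneg_pos sum_nonneg)

lemma limitin_tuple_topology_prefix:
  fixes \<psi> :: "'b \<Rightarrow> nat \<Rightarrow> real"
  assumes "\<And>i. i < n \<Longrightarrow> ((\<lambda>k. \<psi> k i) \<longlongrightarrow> w i) F"
  shows "limitin (tuple_topology n) (\<lambda>k. map (\<psi> k) [0..<n]) (map w [0..<n]) F"
proof -
  let ?P = "product_topology (\<lambda>_. euclideanreal) {..<n}"
  let ?f = "\<lambda>l. \<lambda>i\<in>{..<n}. l ! i :: real"
  have f: "?f (map v [0..<n]) = restrict v {..<n}" for v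
    by (auto simp: restrict_def fun_eq_iff)
  have tup: "map v [0..<n] \<in> tuples n UNIV" for v :: "nat \<Rightarrow> real"
    by (simp add: prefix_in_tuples)
  have lim: "limitin ?P (\<lambda>k. restrict (\<psi> k) {..<n}) (restrict w {..<n}) F"
    using assms by (auto simp: limitin_componentwise)
  show ?thesis
    unfolding limitin_def tuple_topology_def
  proof (intro conjI allI impI)
    show "map w [0..<n] \<in> topspace (pullback_topology (tuples n UNIV) ?f ?P)"
      by (simp add: topspace_pullback_topology tup)
  next
    fix U assume U: "openin (pullback_topology (tuples n UNIV) ?f ?P) U \<and> map w [0..<n] \<in> U"
    then obtain V where V: "openin ?P V" and UV: "U = ?f -` V \<inter> tuples n UNIV"
      by (auto simp: openin_pullback_topology)
    have mem: "map v [0..<n] \<in> U \<longleftrightarrow> restrict v {..<n} \<in> V" for v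
      unfolding UV using tup by (simp only: vimage_eq Int_iff f simp_thms)
    show "\<forall>\<^sub>F k in F. map (\<psi> k) [0..<n] \<in> U"
      using lim U V unfolding limitin_def mem by blast
  qed
qed

lemma prefix_mean_tendsto:
  assumes "continuous_in_weights R I M" and "range x \<subseteq> I"
    and "\<And>k. \<psi> k \<in> W0 R" and "w \<in> W0 R" and "\<And>n. ((\<lambda>k. \<psi> k n) \<longlongrightarrow> w n) F"
  shows "((\<lambda>k. M (map x [0..<Suc n]) (map (\<psi> k) [0..<Suc n]))
           \<longlongrightarrow> M (map x [0..<Suc n]) (map w [0..<Suc n])) F"
proof -
  let ?T = "subtopology (tuple_topology (Suc n)) (weights (Suc n) R)"
  have "continuous_map ?T euclideanreal (M (map x [0..<Suc n]))"
    using assms(1) prefix_in_tuples[OF assms(2)] by (auto simp only: continuous_in_weights_def)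
  moreover have "limitin ?T (\<lambda>k. map (\<psi> k) [0..<Suc n]) (map w [0..<Suc n]) F"
    unfolding limitin_subtopology
    by (intro conjI limitin_tuple_topology_prefix prefix_in_weights always_eventually allI assms)
  ultimately show ?thesis
    unfolding limitin_canonical_iff[symmetric] by (rule continuous_map_limit[unfolded o_def])
qed

text \<open>
  Elements of \<open>I\<close> can be chosen as close to zero as desired, so a geometric series
  divided by the weights bounds the tail regardless of how fast the weights grow.
\<close>

lemma extension_with_small_tail:
  fixes p x :: "nat \<Rightarrow> real"
  assumes nonneg: "\<And>v. v \<in> I \<Longrightarrow> 0 \<le> v" and small: "\<And>\<delta>. 0 < \<delta> \<Longrightarrow> \<exists>v\<in>I. v < \<delta>"
    and p: "\<And>n. 0 < p n" and x: "range x \<subseteq> I" and e: "0 < e"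
  obtains y where "range y \<subseteq> I" "\<And>n. n < N \<Longrightarrow> y n = x n"
    "(\<Sum>n. ereal (p n * y n)) \<le> ereal ((\<Sum>n<N. p n * x n) + e)"
proof -
  have "\<exists>v\<in>I. v < e * (1/2) ^ Suc n / p n" for n
    using small e p[of n] by simp
  then obtain z where zI: "\<And>n. z n \<in> I" and z: "\<And>n. z n < e * (1/2) ^ Suc n / p n"
    by metis
  define y where "y n = (if n < N then x n else z n)" for n
  define b where "b n = (if n \<in> {..<N} then p n * x n else 0) + e * (1/2) ^ Suc n" for n
  have y: "range y \<subseteq> I" using zI x by (auto simp: y_def)
  have "b sums ((\<Sum>n<N. p n * x n) + e * 1)"
    unfolding b_def
    by (intro sums_add sums_If_finite_set sums_mult power_half_series) simp
  then have "(\<Sum>n. ereal (b n)) = ereal ((\<Sum>n<N. p n * x n) + e)"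
    by (intro sums_unique[symmetric]) (simp only: sums_ereal mult_1_right)
  moreover have "(\<Sum>n. ereal (p n * y n)) \<le> (\<Sum>n. ereal (b n))"
  proof (rule suminf_le_pos)
    fix n
    show "0 \<le> ereal (p n * y n)"
      using nonneg[of "y n"] y p[of n] by (simp add: range_subsetD)
    have "p n * z n \<le> e * (1/2) ^ Suc n"
      using z[of n] p[of n] by (simp add: field_simps)
    then show "ereal (p n * y n) \<le> ereal (b n)"
      using e by (auto simp: y_def b_def)
  qed
  ultimately show thesis
    using that[of y] y by (simp add: y_def)
qed

text \<open>
  The right-hand sum is nonnegative, so a valid constant remains valid when it is increased; as
  the infimum of the valid constants is itself valid, the invalid constants are exactly those
  strictly below it.
\<close>

lemma less_weighted_Hardy_constant_iff:
  assumes "(INF x\<in>I. ereal x) = 0" and "weighted_mean R I M" and "w \<in> W0 R"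
  shows "c < weighted_Hardy_constant I M w \<longleftrightarrow>
    (\<exists>x. range x \<subseteq> I \<and> c * (\<Sum>n. ereal (w n * x n))
       < (\<Sum>n. ereal (w n * M (map x [0..<Suc n]) (map w [0..<Suc n]))))" (is "_ \<longleftrightarrow> ?viol")
proof -
  let ?H = "weighted_Hardy_constant I M w"
  let ?S = "\<lambda>x. \<Sum>n. ereal (w n * x n)"
  have viol: "?viol \<longleftrightarrow> \<not> weighted_Hardy_inequality I M w c"
    unfolding weighted_Hardy_inequality_def by (auto simp: not_le)
  have nonneg: "0 \<le> v" if "v \<in> I" for v
    using INF_lower[OF that, of ereal] assms(1) by simp
  have S: "0 \<le> ?S x" if "range x \<subseteq> I" for x
    using that nonneg assms(3)
    by (intro suminf_0_le) (auto simp: W0_def range_subsetD less_imp_le)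
  have "weighted_Hardy_inequality I M w c" if "?H \<le> c"
    using weighted_Hardy_constant_is_least(1)[OF assms] ereal_mult_right_mono[OF that S]
    unfolding weighted_Hardy_inequality_def by (meson order_trans)
  then show ?thesis
    using weighted_Hardy_constant_is_least(2)[OF assms] viol by (meson not_le)
qed

theorem theorem3p7:
  fixes R I :: "real set" and M :: "real list \<Rightarrow> real list \<Rightarrow> real"
  assumes "unital_subring R"
    and "is_interval I" and "(INF x\<in>I. ereal x) = 0"
    and "weighted_mean R I M"
    and "continuous_in_weights R I M"
  shows "pointwise_lower_semicontinuous_on (W0 R) (weighted_Hardy_constant I M)"
  unfolding pointwise_lower_semicontinuous_on_def le_Liminf_iff
proof (intro allI impI)
  fix \<psi> :: "nat \<Rightarrow> nat \<Rightarrow> real" and w c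
  assume \<psi>: "\<forall>k. \<psi> k \<in> W0 R" and w: "w \<in> W0 R" and lim: "\<forall>n. (\<lambda>k. \<psi> k n) \<longlonglongrightarrow> w n"
    and c: "c < weighted_Hardy_constant I M w"
  define A where "A v x n = v n * M (map x [0..<Suc n]) (map v [0..<Suc n])" for v x n
  note less_H_iff = less_weighted_Hardy_constant_iff[OF assms(3,4), folded A_def]
  have nonneg: "0 \<le> v" if "v \<in> I" for v
    using INF_lower[OF that, of ereal] assms(3) by simp
  have small: "\<exists>v\<in>I. v < e" if "0 < e" for e
  proof -
    have "(INF x\<in>I. ereal x) < ereal e" using assms(3) that by simp
    then show ?thesis by (auto simp: INF_less_iff)
  qed
  have pos: "0 < v n" if "v \<in> W0 R" for v n
    using that by (simp add: W0_def)
  have A_nonneg: "0 \<le> A v x n" if "v \<in> W0 R" "range x \<subseteq> I" for v x n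
  proof -
    have "M (map x [0..<Suc n]) (map v [0..<Suc n]) \<in> I"
      using assms(4)[unfolded weighted_mean_def, THEN conjunct1]
        prefix_in_tuples[OF that(2)] prefix_in_weights[OF that(1)] by blast
    then show ?thesis
      unfolding A_def using nonneg pos[OF that(1)] by (simp add: less_imp_le)
  qed
  have term_nonneg: "0 \<le> v n * x n" if "v \<in> W0 R" "range x \<subseteq> I" for v x n
    using that nonneg pos by (simp add: range_subsetD less_imp_le)
  obtain x where x: "range x \<subseteq> I" and viol: "c * (\<Sum>n. ereal (w n * x n)) < (\<Sum>n. ereal (A w x n))"
    using c less_H_iff[OF w] by blast
  show "\<forall>\<^sub>F k in sequentially. c < weighted_Hardy_constant I M (\<psi> k)"
  proof (cases "c < 0")
    case True
    have "\<exists>m. x m \<noteq> 0"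
    proof (rule ccontr)
      assume "\<not> (\<exists>m. x m \<noteq> 0)"
      then have x0: "x n = 0" for n by simp
      have "A w x n = 0" for n
      proof -
        have "set (map x [0..<Suc n]) = {0}" using x0 by auto
        then have "M (map x [0..<Suc n]) (map w [0..<Suc n]) = 0"
          using assms(4)[unfolded weighted_mean_def, THEN conjunct2, THEN conjunct2, THEN conjunct2, THEN conjunct1,
              rule_format, OF prefix_in_tuples[OF x] prefix_in_weights[OF w], of n]
          by (simp only: Max_singleton Min_singleton) linarith
        then show ?thesis by (simp only: A_def mult_zero_right)
      qed
      then show False using viol x0 by (simp flip: zero_ereal_def)
    qed
    then obtain m where m: "x m \<noteq> 0" by blast
    have "c < weighted_Hardy_constant I M (\<psi> k)" for k
    proof -
      let ?S = "\<Sum>n. ereal (\<psi> k n * x n)"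
      have \<psi>k: "\<psi> k \<in> W0 R" using \<psi> by blast
      have "0 < ?S"
      proof -
        have "0 \<le> ?S" by (intro suminf_0_le) (simp add: term_nonneg[OF \<psi>k x])
        moreover have "?S \<noteq> 0"
          using m pos[OF \<psi>k, of m] term_nonneg[OF \<psi>k x]
          by (subst suminf_ereal_eq_0) (auto intro!: exI[of _ m])
        ultimately show ?thesis by simp
      qed
      then have "c * ?S < 0" using True by (simp add: ereal_mult_less_0_iff)
      also have "0 \<le> (\<Sum>n. ereal (A (\<psi> k) x n))"
        by (intro suminf_0_le) (simp add: A_nonneg[OF \<psi>k x])
      finally show ?thesis using less_H_iff[OF \<psi>k] x by blast
    qed
    then show ?thesis by simp
  next
    case False
    then obtain r where r: "c = ereal r" "0 \<le> r"
      using c by (cases c) auto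
    obtain N where N: "c * (\<Sum>n. ereal (w n * x n)) < ereal (\<Sum>n<N. A w x n)"
      using viol suminf_ereal_eq_SUP[of "\<lambda>n. ereal (A w x n)"] A_nonneg[OF w x]
      by (auto simp: less_SUP_iff)
    define a where "a v = (\<Sum>n<N. A v x n)" for v
    define b where "b v = (\<Sum>n<N. v n * x n)" for v
    have "ereal (b w) \<le> (\<Sum>n. ereal (w n * x n))"
      using suminf_upper[of "\<lambda>n. ereal (w n * x n)" N] term_nonneg[OF w x] by (simp add: b_def)
    then have "ereal (r * b w) \<le> c * (\<Sum>n. ereal (w n * x n))"
      using ereal_mult_left_mono[of "ereal (b w)" _ c] r by simp
    also note N
    finally have ab: "r * b w < a w" by (simp add: a_def)
    define g where "g = a w - r * b w"
    \<comment> \<open>The division by \<open>r + 1\<close> rather than \<open>r\<close> covers the case \<open>r = 0\<close>.\<close>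
    define e where "e = g / 2 / (r + 1)"
    have g: "0 < g" using ab by (simp add: g_def)
    then have e: "0 < e" using r by (simp add: e_def)
    have "r + 1 \<noteq> 0" using r by simp
    then have "e * (r + 1) = g / 2"
      unfolding e_def by (rule nonzero_eq_divide_eq[THEN iffD1]) (rule refl)
    then have "r * e + e = g / 2" by (simp only: distrib_left mult.commute mult_1_right)
    then have "r * e < g" using g e by linarith
    then have gap: "0 < a w - r * (b w + e)" unfolding g_def distrib_left by linarith
    have "(\<lambda>k. a (\<psi> k) - r * (b (\<psi> k) + e)) \<longlonglongrightarrow> a w - r * (b w + e)"
      unfolding a_def b_def A_def
      by (intro tendsto_intros prefix_mean_tendsto[OF assms(5) x]) (use \<psi> w lim in auto)
    from order_tendstoD(1)[OF this gap] show ?thesis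
    proof (rule eventually_mono)
      fix k assume k: "0 < a (\<psi> k) - r * (b (\<psi> k) + e)"
      have \<psi>k: "\<psi> k \<in> W0 R" using \<psi> by blast
      obtain y where y: "range y \<subseteq> I" and yx: "\<And>n. n < N \<Longrightarrow> y n = x n"
        and tail: "(\<Sum>n. ereal (\<psi> k n * y n)) \<le> ereal (b (\<psi> k) + e)"
        unfolding b_def
        by (rule extension_with_small_tail[of I "\<psi> k" x e N, OF nonneg small pos[OF \<psi>k] x e]) auto
      have "c * (\<Sum>n. ereal (\<psi> k n * y n)) \<le> c * ereal (b (\<psi> k) + e)"
        using tail r by (intro ereal_mult_left_mono) auto
      also have "\<dots> < ereal (a (\<psi> k))" using k r by simp
      also have "ereal (a (\<psi> k)) = (\<Sum>n<N. ereal (A (\<psi> k) y n))"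
      proof -
        have "map y [0..<Suc n] = map x [0..<Suc n]" if "n < N" for n
          using that yx by auto
        then have "A (\<psi> k) y n = A (\<psi> k) x n" if "n < N" for n
          using that by (simp only: A_def)
        then show ?thesis by (simp add: a_def)
      qed
      also have "\<dots> \<le> (\<Sum>n. ereal (A (\<psi> k) y n))"
        by (intro suminf_upper) (simp add: A_nonneg[OF \<psi>k y])
      finally show "c < weighted_Hardy_constant I M (\<psi> k)"
        using less_H_iff[OF \<psi>k] y by blast
    qed
  qed
qed

end
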